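(* Consider the linear regression model $y_j=\sum_{i=1}^q\theta_i x_{ji}+\epsilon_j$, $j=1,\dots,N$, where $\theta=(\theta_1,\dots,\theta_q)\in\mathbb{R}^q$ is an unknown parameter, $\epsilon_j$ are i.i.d. random variables, and $X=(x_{ji})$ is a regression design matrix. Let $\widehat\Delta=\min_{\tau\in\mathbb{R}^q}\Delta(\tau)$, where $\Delta(\tau)=\max_{1\le j\le N}\bigl|y_j-\sum_{i=1}^q\tau_i x_{ji}\bigr|$, and let $\widehat\theta$ be the minimax estimator of $\theta$, i.e. a random vector with $\Delta(\widehat\theta)=\widehat\Delta$. Let $Z_N=\max_{1\le j\le N}\epsilon_j$, $W_N=\min_{1\le j\le N}\epsilon_j$, $R_N=Z_N-W_N$, $Q_N=\frac{Z_N+W_N}{2}$. (i) If the model contains a constant term, namely $x_{j1}=1$ for $j=1,\dots,N$, then almost surely $$\widehat\Delta\le\frac{R_N}{2}.$$ (ii) If the model has the form $y_j=\theta+\epsilon_j$, $j=1,\dots,N$ (that is, $q=1$ and $x_{j1}=1$ for all $j$), then almost surely $$\widehat\Delta=\frac{R_N}{2},\qquad \widehat\theta-\theta=Q_N.$$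
   Context: The design matrix $X$ is a deterministic real $N\times q$ matrix. All other notation is defined in the claim. *)

theory Defs
  imports "HOL-Probability.Probability"
begin

definition iid :: "'a measure \<Rightarrow> ('n \<Rightarrow> 'a \<Rightarrow> real) \<Rightarrow> bool" where
  "iid M \<epsilon> \<longleftrightarrow>
     prob_space.indep_vars M (\<lambda>_. borel) \<epsilon> UNIV \<and>
     (\<forall>j k. distr M borel (\<epsilon> j) = distr M borel (\<epsilon> k))"

text \<open>Observations are indexed by a finite type \<open>'n\<close>, so that \<open>N = CARD('n) \<ge> 1\<close>, and
  regressors by a finite type \<open>'q\<close>, so that \<open>q = CARD('q) \<ge> 1\<close>; the entry \<open>x\<^sub>j\<^sub>i\<close> is \<open>X $ j $ i\<close>.\<close>

definition regression_model ::
  "'a measure \<Rightarrow> real ^ 'q ^ 'n \<Rightarrow> real ^ 'q \<Rightarrow> ('n \<Rightarrow> 'a \<Rightarrow> real) \<Rightarrow> ('n \<Rightarrow> 'a \<Rightarrow> real) \<Rightarrow> bool" where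
  "regression_model M X \<theta> \<epsilon> y \<longleftrightarrow>
     iid M \<epsilon> \<and> (\<forall>\<omega>\<in>space M. \<forall>j. y j \<omega> = (\<Sum>i\<in>UNIV. \<theta> $ i * X $ j $ i) + \<epsilon> j \<omega>)"

definition Delta :: "real ^ 'q ^ 'n \<Rightarrow> ('n \<Rightarrow> 'a \<Rightarrow> real) \<Rightarrow> 'a \<Rightarrow> real ^ 'q \<Rightarrow> real" where
  "Delta X y \<omega> \<tau> = (MAX j\<in>UNIV. \<bar>y j \<omega> - (\<Sum>i\<in>UNIV. \<tau> $ i * X $ j $ i)\<bar>)"

text \<open>\<^const>\<open>Min\<close> applies to finite sets only, so the minimum over all of \<open>\<real>\<^sup>q\<close> is expressed as
  the least element of the range.  That it is attained is not part of the definition.\<close>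

definition Delta_hat :: "real ^ 'q ^ 'n \<Rightarrow> ('n \<Rightarrow> 'a \<Rightarrow> real) \<Rightarrow> 'a \<Rightarrow> real" where
  "Delta_hat X y \<omega> = (LEAST d. d \<in> range (Delta X y \<omega>))"

definition minimax_estimator ::
  "'a measure \<Rightarrow> real ^ 'q ^ 'n \<Rightarrow> ('n \<Rightarrow> 'a \<Rightarrow> real) \<Rightarrow> ('a \<Rightarrow> real ^ 'q) \<Rightarrow> bool" where
  "minimax_estimator M X y \<theta>hat \<longleftrightarrow>
     \<theta>hat \<in> borel_measurable M \<and> (AE \<omega> in M. Delta X y \<omega> (\<theta>hat \<omega>) = Delta_hat X y \<omega>)"

definition Z_N :: "('n::finite \<Rightarrow> 'a \<Rightarrow> real) \<Rightarrow> 'a \<Rightarrow> real" where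
  "Z_N \<epsilon> \<omega> = (MAX j\<in>UNIV. \<epsilon> j \<omega>)"

definition W_N :: "('n::finite \<Rightarrow> 'a \<Rightarrow> real) \<Rightarrow> 'a \<Rightarrow> real" where
  "W_N \<epsilon> \<omega> = (MIN j\<in>UNIV. \<epsilon> j \<omega>)"

definition R_N :: "('n::finite \<Rightarrow> 'a \<Rightarrow> real) \<Rightarrow> 'a \<Rightarrow> real" where
  "R_N \<epsilon> \<omega> = Z_N \<epsilon> \<omega> - W_N \<epsilon> \<omega>"

definition Q_N :: "('n::finite \<Rightarrow> 'a \<Rightarrow> real) \<Rightarrow> 'a \<Rightarrow> real" where
  "Q_N \<epsilon> \<omega> = (Z_N \<epsilon> \<omega> + W_N \<epsilon> \<omega>) / 2"

end

theory Submission
  imports Defs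
begin

text \<open>
  Writing \<open>\<tau> = \<theta> + \<sigma>\<close>, the residuals of \<open>\<tau>\<close> are the errors \<open>\<epsilon>\<^sub>j\<close> minus the fitted values of the
  shift \<open>\<sigma>\<close>. If the model has a constant term, \<open>\<sigma>\<close> may be chosen so that every error is shifted by the
  same number \<open>t\<close>, and the maximal absolute value of the shifted errors is then exactly
  \<open>R\<^sub>N / 2 + \<bar>t - Q\<^sub>N\<bar>\<close> (lemma \<open>Max_abs_shift\<close>): the best constant is the midrange. The choice
  \<open>t = Q\<^sub>N\<close> bounds the minimum by \<open>R\<^sub>N / 2\<close>. When the constant is the only regressor, there are no
  other shifts, so \<open>R\<^sub>N / 2\<close> is the minimum and \<open>t = Q\<^sub>N\<close> the only minimizer.

  The argument is pointwise; for the formula of the estimator, \<open>\<omega>\<close> ranges over the points where the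
  estimate attains the minimum. Since
  \<^const>\<open>Delta_hat\<close> is a least element, it is meaningful only if the minimum exists, and for an
  arbitrary design matrix this needs a compactness argument (lemma \<open>Delta_attains_min\<close>).
\<close>

text \<open>For a rank-deficient \<open>X\<close> the sublevel sets of \<open>Delta X y \<omega>\<close> in the parameter space are unbounded.
  The compactness argument therefore takes place among the fitted values, where they are bounded: the
  column space of \<open>X\<close> is closed, being a finite-dimensional subspace.\<close>

lemma Delta_attains_min:
  fixes X :: "real ^ 'q ^ 'n"
  shows "\<exists>\<tau>. \<forall>\<sigma>. Delta X y \<omega> \<tau> \<le> Delta X y \<omega> \<sigma>"
proof -
  define f where "f v = (MAX j\<in>UNIV. \<bar>y j \<omega> - v $ j\<bar>)" for v :: "real ^ 'n"
  have Delta_f: "Delta X y \<omega> \<tau> = f (X *v \<tau>)" for \<tau>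
    by (simp add: Delta_def f_def matrix_vector_mult_def mult.commute)
  have f_infnorm: "f v = infnorm ((\<chi> j. y j \<omega>) - v)" for v
    by (simp add: f_def infnorm_cart full_SetCompr_eq cSup_eq_Max)
  define V where "V = range ((*v) X)"
  define K where "K = V \<inter> {v. f v \<le> f 0}"
  have "closed V"
    unfolding V_def
    by (intro closed_subspace linear_subspace_image matrix_vector_mul_linear subspace_UNIV)
  moreover have "{v. f v \<le> f 0} = cbox (\<chi> j. y j \<omega> - f 0) (\<chi> j. y j \<omega> + f 0)"
  proof -
    have "f v \<le> c \<longleftrightarrow> (\<forall>j. y j \<omega> - c \<le> v $ j \<and> v $ j \<le> y j \<omega> + c)" for v c
      unfolding f_def by (auto simp: abs_le_iff diff_le_eq add.commute)
    then show ?thesis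
      by (simp add: set_eq_iff mem_box_cart)
  qed
  ultimately have "compact K"
    unfolding K_def by (simp add: closed_Int_compact)
  moreover have "0 \<in> K"
    unfolding K_def V_def by (auto intro: image_eqI[where x = 0])
  moreover have "continuous_on K f"
    unfolding f_infnorm by (intro continuous_intros)
  ultimately obtain v where v: "v \<in> K" "\<And>w. w \<in> K \<Longrightarrow> f v \<le> f w"
    using continuous_attains_inf[of K f] by blast
  have "f v \<le> f w" if "w \<in> V" for w
  proof (cases "f w \<le> f 0")
    case True
    then show ?thesis using v(2) that by (simp add: K_def)
  next
    case False
    then show ?thesis using v(2)[OF \<open>0 \<in> K\<close>] by simp
  qed
  with v(1) show ?thesis
    by (auto simp: K_def V_def Delta_f)
qed

lemma Delta_hat_eqI:
  assumes "\<And>\<sigma>. Delta X y \<omega> \<tau> \<le> Delta X y \<omega> \<sigma>"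
  shows "Delta_hat X y \<omega> = Delta X y \<omega> \<tau>"
  unfolding Delta_hat_def using assms by (intro Least_equality) auto

lemma Delta_hat_le: "Delta_hat X y \<omega> \<le> Delta X y \<omega> \<sigma>"
  using Delta_attains_min[of X y \<omega>] Delta_hat_eqI[of X y \<omega>] by metis

text \<open>The extreme shifted values are \<open>Z\<^sub>N - t\<close> and \<open>W\<^sub>N - t\<close>, so the maximum is that of \<open>Z\<^sub>N - t\<close> and
  \<open>t - W\<^sub>N\<close>; these are \<open>R\<^sub>N / 2 \<mp> (t - Q\<^sub>N)\<close>.\<close>

lemma Max_abs_shift:
  fixes \<epsilon> :: "'n::finite \<Rightarrow> 'a \<Rightarrow> real"
  shows "(MAX j\<in>UNIV. \<bar>\<epsilon> j \<omega> - t\<bar>) = R_N \<epsilon> \<omega> / 2 + \<bar>t - Q_N \<epsilon> \<omega>\<bar>"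
proof -
  let ?Z = "Z_N \<epsilon> \<omega>" and ?W = "W_N \<epsilon> \<omega>"
  have bounds: "?W \<le> \<epsilon> j \<omega>" "\<epsilon> j \<omega> \<le> ?Z" for j
    by (simp_all add: Z_N_def W_N_def)
  have "?Z \<in> range (\<lambda>j. \<epsilon> j \<omega>)"
    unfolding Z_N_def by (rule Max_in) auto
  then obtain a where a: "\<epsilon> a \<omega> = ?Z" by auto
  have "?W \<in> range (\<lambda>j. \<epsilon> j \<omega>)"
    unfolding W_N_def by (rule Min_in) auto
  then obtain b where b: "\<epsilon> b \<omega> = ?W" by auto
  have "(MAX j\<in>UNIV. \<bar>\<epsilon> j \<omega> - t\<bar>) = max (?Z - t) (t - ?W)"
  proof (rule antisym)
    have "\<bar>\<epsilon> j \<omega> - t\<bar> \<le> max (?Z - t) (t - ?W)" for j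
      using bounds[of j] by linarith
    then show "(MAX j\<in>UNIV. \<bar>\<epsilon> j \<omega> - t\<bar>) \<le> max (?Z - t) (t - ?W)"
      by simp
    have "\<bar>\<epsilon> j \<omega> - t\<bar> \<le> (MAX j\<in>UNIV. \<bar>\<epsilon> j \<omega> - t\<bar>)" for j
      by (rule Max_ge) auto
    from this[of a] this[of b] show "max (?Z - t) (t - ?W) \<le> (MAX j\<in>UNIV. \<bar>\<epsilon> j \<omega> - t\<bar>)"
      unfolding a b by linarith
  qed
  also have "\<dots> = R_N \<epsilon> \<omega> / 2 + \<bar>t - Q_N \<epsilon> \<omega>\<bar>"
    unfolding R_N_def Q_N_def by (simp add: max_def abs_if field_simps)
  finally show ?thesis .
qed

lemma Delta_constant_shift:
  assumes "regression_model M X \<theta> \<epsilon> y" "\<omega> \<in> space M"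
    and "\<And>j. (\<Sum>i\<in>UNIV. \<tau> $ i * X $ j $ i) = (\<Sum>i\<in>UNIV. \<theta> $ i * X $ j $ i) + t"
  shows "Delta X y \<omega> \<tau> = R_N \<epsilon> \<omega> / 2 + \<bar>t - Q_N \<epsilon> \<omega>\<bar>"
proof -
  have "y j \<omega> - (\<Sum>i\<in>UNIV. \<tau> $ i * X $ j $ i) = \<epsilon> j \<omega> - t" for j
    using assms by (simp add: regression_model_def)
  then show ?thesis
    by (simp add: Delta_def Max_abs_shift)
qed

lemma Delta_hat_le_half_range:
  fixes X :: "real ^ 'q ^ 'n"
  assumes "regression_model M X \<theta> \<epsilon> y" "\<omega> \<in> space M" "\<And>j. X $ j $ k = 1"
  shows "Delta_hat X y \<omega> \<le> R_N \<epsilon> \<omega> / 2"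
proof -
  let ?\<tau> = "\<theta> + axis k (Q_N \<epsilon> \<omega>)"
  have "(\<Sum>i\<in>UNIV. ?\<tau> $ i * X $ j $ i) = (\<Sum>i\<in>UNIV. \<theta> $ i * X $ j $ i) + Q_N \<epsilon> \<omega>" for j
    by (simp add: axis_def distrib_right sum.distrib if_distrib[of "\<lambda>c. c * _"] assms(3)
             cong: if_cong)
  then have "Delta X y \<omega> ?\<tau> = R_N \<epsilon> \<omega> / 2"
    using Delta_constant_shift[OF assms(1,2)] by simp
  then show ?thesis
    using Delta_hat_le[of X y \<omega> ?\<tau>] by simp
qed

text \<open>Here every parameter is a constant shift of \<open>\<theta>\<close>, so the formula for the shifted maximum describes
  the whole objective function. Its minimum follows from the bound above together with the
  nonnegativity of the second summand, and an estimate attaining it must make that summand vanish.\<close>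

lemma minimax_location_model:
  fixes X :: "real ^ 'q ^ 'n"
  assumes model: "regression_model M X \<theta> \<epsilon> y" "\<omega> \<in> space M"
    and one: "CARD('q) = 1" "\<And>j i. X $ j $ i = 1"
    and opt: "Delta X y \<omega> \<tau> = Delta_hat X y \<omega>"
  shows "Delta_hat X y \<omega> = R_N \<epsilon> \<omega> / 2 \<and> (\<forall>i. \<tau> $ i - \<theta> $ i = Q_N \<epsilon> \<omega>)"
proof -
  obtain k :: 'q where k: "UNIV = {k}"
    using one(1) by (auto simp: card_1_singleton_iff)
  have "Delta X y \<omega> \<tau> = R_N \<epsilon> \<omega> / 2 + \<bar>(\<tau> $ k - \<theta> $ k) - Q_N \<epsilon> \<omega>\<bar>"
    by (rule Delta_constant_shift[OF model]) (simp add: k one(2))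
  moreover have "Delta_hat X y \<omega> \<le> R_N \<epsilon> \<omega> / 2"
    by (rule Delta_hat_le_half_range[OF model one(2)])
  ultimately have "Delta_hat X y \<omega> = R_N \<epsilon> \<omega> / 2" "\<tau> $ k - \<theta> $ k = Q_N \<epsilon> \<omega>"
    using opt by linarith+
  moreover have "(\<forall>i. \<tau> $ i - \<theta> $ i = Q_N \<epsilon> \<omega>) \<longleftrightarrow> (\<forall>i\<in>{k}. \<tau> $ i - \<theta> $ i = Q_N \<epsilon> \<omega>)"
    unfolding k[symmetric] by simp
  ultimately show ?thesis
    by simp
qed

theorem mainTheorem4:
  fixes M :: "'a measure"
    and X :: "real ^ 'q ^ 'n"
    and \<theta> :: "real ^ 'q"
    and \<epsilon> y :: "'n \<Rightarrow> 'a \<Rightarrow> real"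
    and \<theta>hat :: "'a \<Rightarrow> real ^ 'q"
  assumes "prob_space M"
    and "regression_model M X \<theta> \<epsilon> y"
    and "minimax_estimator M X y \<theta>hat"
  shows "((\<exists>i. \<forall>j. X $ j $ i = 1) \<longrightarrow>
            (AE \<omega> in M. Delta_hat X y \<omega> \<le> R_N \<epsilon> \<omega> / 2)) \<and>
         (CARD('q) = 1 \<and> (\<forall>j i. X $ j $ i = 1) \<longrightarrow>
            (AE \<omega> in M. Delta_hat X y \<omega> = R_N \<epsilon> \<omega> / 2 \<and> (\<forall>i. \<theta>hat \<omega> $ i - \<theta> $ i = Q_N \<epsilon> \<omega>)))"
proof (intro conjI impI)
  assume "\<exists>i. \<forall>j. X $ j $ i = 1"
  then show "AE \<omega> in M. Delta_hat X y \<omega> \<le> R_N \<epsilon> \<omega> / 2"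
    using Delta_hat_le_half_range[OF assms(2)] by (auto intro: AE_I2)
next
  assume one: "CARD('q) = 1 \<and> (\<forall>j i. X $ j $ i = 1)"
  have "AE \<omega> in M. Delta X y \<omega> (\<theta>hat \<omega>) = Delta_hat X y \<omega>"
    using assms(3) by (simp add: minimax_estimator_def)
  then show "AE \<omega> in M. Delta_hat X y \<omega> = R_N \<epsilon> \<omega> / 2 \<and>
      (\<forall>i. \<theta>hat \<omega> $ i - \<theta> $ i = Q_N \<epsilon> \<omega>)"
    using AE_space
    by eventually_elim (rule minimax_location_model[OF assms(2)]; use one in blast)
qed

end
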